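(* For every natural number $n \geq 0$, the empty clause $\vdash$ is derivable by resolution from the clause set $C(n)$.
   Context: Language: first-order terms are built from variables, a unary function symbol $s$ and a binary function symbol $max$; there are also a unary function symbol $f$ and constants (numerals) $\overline{0},\overline{1},\overline{2},\dots$. Atoms are of the form $u\leq v$ or $f(u)=\overline{i}$; both $\leq$ and $=$ are treated as ordinary (uninterpreted) predicate symbols, with no built-in equality or arithmetic axioms. A clause is a sequent $\Pi\vdash\Delta$ with $\Pi,\Delta$ finite multisets of atoms; its variables are implicitly universally quantified. The numeral $\overline{i}$ is also written $i$. For $n\geq 0$, $C(n)$ is the set of the following clauses ($\alpha,\beta,\gamma$ variables): (C1) $\vdash \alpha\leq\alpha$; (C2) $max(\alpha,\beta)\leq\gamma\vdash\alpha\leq\gamma$; (C3) $max(\alpha,\beta)\leq\gamma\vdash\beta\leq\gamma$; (C4$_i$) $f(\beta)=\overline{i},\ f(\alpha)=\overline{i},\ s(\beta)\leq\alpha\vdash$, for each $0\leq i\leq n$; (C5) $\vdash f(\alpha)=\overline{0},\dots,f(\alpha)=\overline{n}$. Resolution rule: from $\Pi\vdash P^{*},\Delta$ and $\Pi',P^{**}\vdash\Delta'$ and a substitution $\sigma$ with $P^{*}\sigma=P^{**}\sigma=P$, where $P$ does not occur in $\Pi'\sigma$ nor in $\Delta\sigma$, infer $\Pi\sigma,\Pi'\sigma\vdash\Delta\sigma,\Delta'\sigma$. A clause is derivable by resolution from $C(n)$ if it is obtained from clauses of $C(n)$ by finitely many applications of this rule, together with taking substitution instances (in particular renaming variables) and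 contracting duplicate atoms on either side of $\vdash$. *)

theory Defs
  imports "HOL-Library.Multiset"
begin

text \<open>The symbols \<open>f\<close> and the numerals occur only in atoms \<open>f(u) = i\<close>, so they are built
  into the atoms; \<open>Leq\<close> and \<open>FEq\<close> are free constructors, i.e. uninterpreted.\<close>

datatype trm = Var nat | Succ trm | MaxT trm trm

datatype atm =
    Leq trm trm
  | FEq trm nat \<comment> \<open>\<open>FEq u i\<close> is the atom \<open>f(u) = i\<close>, with \<open>i\<close> the numeral\<close>

datatype clause = Sequent "atm multiset" "atm multiset" (infix \<open>\<turnstile>\<close> 50)

type_synonym subst = "nat \<Rightarrow> trm"

primrec subst_trm :: "subst \<Rightarrow> trm \<Rightarrow> trm" where
  "subst_trm \<sigma> (Var x) = \<sigma> x"
| "subst_trm \<sigma> (Succ u) = Succ (subst_trm \<sigma> u)"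
| "subst_trm \<sigma> (MaxT u v) = MaxT (subst_trm \<sigma> u) (subst_trm \<sigma> v)"

primrec subst_atm :: "subst \<Rightarrow> atm \<Rightarrow> atm" where
  "subst_atm \<sigma> (Leq u v) = Leq (subst_trm \<sigma> u) (subst_trm \<sigma> v)"
| "subst_atm \<sigma> (FEq u i) = FEq (subst_trm \<sigma> u) i"

abbreviation subst_atms :: "subst \<Rightarrow> atm multiset \<Rightarrow> atm multiset" where
  "subst_atms \<sigma> \<equiv> image_mset (subst_atm \<sigma>)"

text \<open>In \<open>resolution\<close> a single substitution acts on both premises, which may share variables;
  renaming apart is done beforehand with \<open>instance_of\<close>.\<close>

inductive derivable :: "clause set \<Rightarrow> clause \<Rightarrow> bool" for \<C> :: "clause set" where
  input: "c \<in> \<C> \<Longrightarrow> derivable \<C> c"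
| instance_of: "derivable \<C> (\<Pi> \<turnstile> \<Delta>) \<Longrightarrow> derivable \<C> (subst_atms \<sigma> \<Pi> \<turnstile> subst_atms \<sigma> \<Delta>)"
| contract_left:
    "derivable \<C> (add_mset A (add_mset A \<Pi>) \<turnstile> \<Delta>) \<Longrightarrow> derivable \<C> (add_mset A \<Pi> \<turnstile> \<Delta>)"
| contract_right:
    "derivable \<C> (\<Pi> \<turnstile> add_mset A (add_mset A \<Delta>)) \<Longrightarrow> derivable \<C> (\<Pi> \<turnstile> add_mset A \<Delta>)"
| resolution:
    "\<lbrakk> derivable \<C> (\<Pi> \<turnstile> add_mset P1 \<Delta>);
       derivable \<C> (add_mset P2 \<Pi>' \<turnstile> \<Delta>');
       subst_atm \<sigma> P1 = P; subst_atm \<sigma> P2 = P;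
       P \<notin># subst_atms \<sigma> \<Pi>'; P \<notin># subst_atms \<sigma> \<Delta> \<rbrakk>
     \<Longrightarrow> derivable \<C>
          (subst_atms \<sigma> \<Pi> + subst_atms \<sigma> \<Pi>' \<turnstile> subst_atms \<sigma> \<Delta> + subst_atms \<sigma> \<Delta>')"

abbreviation \<alpha> :: trm where "\<alpha> \<equiv> Var 0"
abbreviation \<beta> :: trm where "\<beta> \<equiv> Var 1"
abbreviation \<gamma> :: trm where "\<gamma> \<equiv> Var 2"

definition C :: "nat \<Rightarrow> clause set" where
  "C n =
     { {#} \<turnstile> {# Leq \<alpha> \<alpha> #},
       {# Leq (MaxT \<alpha> \<beta>) \<gamma> #} \<turnstile> {# Leq \<alpha> \<gamma> #},
       {# Leq (MaxT \<alpha> \<beta>) \<gamma> #} \<turnstile> {# Leq \<beta> \<gamma> #} }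
     \<union> { {# FEq \<beta> i, FEq \<alpha> i, Leq (Succ \<beta>) \<alpha> #} \<turnstile> {#} | i. i \<le> n }
     \<union> { {#} \<turnstile> {# FEq \<alpha> i. i \<in># mset_set {0..n} #} }"

end

theory Submission imports Defs begin

text \<open>Let \<open>t\<^sub>0\<close> be a variable and \<open>t\<^sub>j\<^sub>+\<^sub>1 = max(s(t\<^sub>j), t\<^sub>j)\<close>. Peeling off maxima from
  \<open>t\<^sub>j \<le> t\<^sub>j\<close> yields \<open>s(t\<^sub>i) \<le> t\<^sub>j\<close> for all \<open>i < j\<close>, so by (C4) \<open>t\<^sub>i\<close> and \<open>t\<^sub>j\<close> never have the
  same \<open>f\<close>-value. By (C5) each of \<open>t\<^sub>0, \<dots>, t\<^sub>n\<^sub>+\<^sub>1\<close> has one of \<open>n + 1\<close> values. The pigeonhole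
  principle closes every branch of the decision tree that fixes the values of
  \<open>t\<^sub>0, t\<^sub>1, \<dots>\<close> in turn, and the tree is collapsed into a resolution refutation from the leaves
  to the root.\<close>

text \<open>Reading sequents as sets, up to weakening, makes cut admissible without the side conditions
  of the resolution rule.\<close>

definition derives :: "clause set \<Rightarrow> atm set \<Rightarrow> atm set \<Rightarrow> bool" where
  "derives \<C> S T \<longleftrightarrow> (\<exists>\<Pi> \<Delta>. set_mset \<Pi> \<subseteq> S \<and> set_mset \<Delta> \<subseteq> T \<and> derivable \<C> (\<Pi> \<turnstile> \<Delta>))"

lemma derives_empty: "derives \<C> {} {} \<longleftrightarrow> derivable \<C> ({#} \<turnstile> {#})"
  by (auto simp: derives_def)

lemma derives_input: "(\<Pi> \<turnstile> \<Delta>) \<in> \<C> \<Longrightarrow> derives \<C> (set_mset \<Pi>) (set_mset \<Delta>)"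
  unfolding derives_def using derivable.input by blast

lemma derives_mono: "derives \<C> S T \<Longrightarrow> S \<subseteq> S' \<Longrightarrow> T \<subseteq> T' \<Longrightarrow> derives \<C> S' T'"
  unfolding derives_def by blast

lemma derives_subst:
  assumes "derives \<C> S T"
  shows "derives \<C> (subst_atm \<sigma> ` S) (subst_atm \<sigma> ` T)"
proof -
  obtain \<Pi> \<Delta> where "set_mset \<Pi> \<subseteq> S" "set_mset \<Delta> \<subseteq> T" "derivable \<C> (\<Pi> \<turnstile> \<Delta>)"
    using assms unfolding derives_def by blast
  moreover from this have "derivable \<C> (subst_atms \<sigma> \<Pi> \<turnstile> subst_atms \<sigma> \<Delta>)"
    by (intro derivable.instance_of)
  ultimately show ?thesis
    unfolding derives_def by (metis image_mono set_image_mset)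
qed

text \<open>Resolution removes a single copy of the cut atom and forbids further copies of it beside
  that one on the same side. Hence all copies are first merged into one, by induction on their
  number.\<close>

lemma contract_left_all:
  assumes "derivable \<C> (\<Pi> \<turnstile> \<Delta>)" "A \<in># \<Pi>"
  obtains \<Pi>' where "derivable \<C> (add_mset A \<Pi>' \<turnstile> \<Delta>)" "set_mset \<Pi>' = set_mset \<Pi> - {A}"
  using assms
proof (induction "count \<Pi> A" arbitrary: \<Pi> thesis rule: less_induct)
  case less
  obtain \<Pi>0 where \<Pi>: "\<Pi> = add_mset A \<Pi>0"
    using less.prems(3) by (metis multi_member_split)
  show ?case
  proof (cases "A \<in># \<Pi>0")
    case True
    then obtain \<Pi>1 where \<Pi>0: "\<Pi>0 = add_mset A \<Pi>1"
      by (metis multi_member_split)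
    have "derivable \<C> (\<Pi>0 \<turnstile> \<Delta>)"
      using less.prems(2) unfolding \<Pi> \<Pi>0 by (rule derivable.contract_left)
    then show ?thesis
      using less.hyps[of \<Pi>0] less.prems(1) True \<Pi> by auto
  next
    case False
    then show ?thesis
      using less.prems(1)[of \<Pi>0] less.prems(2) \<Pi> by simp
  qed
qed

lemma contract_right_all:
  assumes "derivable \<C> (\<Pi> \<turnstile> \<Delta>)" "A \<in># \<Delta>"
  obtains \<Delta>' where "derivable \<C> (\<Pi> \<turnstile> add_mset A \<Delta>')" "set_mset \<Delta>' = set_mset \<Delta> - {A}"
  using assms
proof (induction "count \<Delta> A" arbitrary: \<Delta> thesis rule: less_induct)
  case less
  obtain \<Delta>0 where \<Delta>: "\<Delta> = add_mset A \<Delta>0"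
    using less.prems(3) by (metis multi_member_split)
  show ?case
  proof (cases "A \<in># \<Delta>0")
    case True
    then obtain \<Delta>1 where \<Delta>0: "\<Delta>0 = add_mset A \<Delta>1"
      by (metis multi_member_split)
    have "derivable \<C> (\<Pi> \<turnstile> \<Delta>0)"
      using less.prems(2) unfolding \<Delta> \<Delta>0 by (rule derivable.contract_right)
    then show ?thesis
      using less.hyps[of \<Delta>0] less.prems(1) True \<Delta> by auto
  next
    case False
    then show ?thesis
      using less.prems(1)[of \<Delta>0] less.prems(2) \<Delta> by simp
  qed
qed

lemma subst_trm_Var: "subst_trm Var u = u"
  by (induction u) auto

lemma subst_atm_Var: "subst_atm Var = id"
proof
  fix A
  show "subst_atm Var A = id A"
    by (cases A) (auto simp: subst_trm_Var)
qed

text \<open>Once \<open>A\<close> is contracted to one occurrence in each premise, the side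
  conditions of resolution hold with the identity substitution \<open>Var\<close>.\<close>

lemma derives_cut:
  assumes "derives \<C> S (insert A T)" "derives \<C> (insert A S) T"
  shows "derives \<C> S T"
proof -
  obtain \<Pi> \<Delta> where 1: "set_mset \<Pi> \<subseteq> S" "set_mset \<Delta> \<subseteq> insert A T" "derivable \<C> (\<Pi> \<turnstile> \<Delta>)"
    using assms(1) unfolding derives_def by blast
  obtain \<Pi>' \<Delta>' where 2: "set_mset \<Pi>' \<subseteq> insert A S" "set_mset \<Delta>' \<subseteq> T" "derivable \<C> (\<Pi>' \<turnstile> \<Delta>')"
    using assms(2) unfolding derives_def by blast
  show ?thesis
  proof (cases "A \<in># \<Delta> \<and> A \<in># \<Pi>'")
    case True
    then obtain \<Delta>0 \<Pi>0 where
      d1: "derivable \<C> (\<Pi> \<turnstile> add_mset A \<Delta>0)" and \<Delta>0: "set_mset \<Delta>0 = set_mset \<Delta> - {A}" and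
      d2: "derivable \<C> (add_mset A \<Pi>0 \<turnstile> \<Delta>')" and \<Pi>0: "set_mset \<Pi>0 = set_mset \<Pi>' - {A}"
      using contract_right_all[OF 1(3)] contract_left_all[OF 2(3)] by metis
    have "derivable \<C> (\<Pi> + \<Pi>0 \<turnstile> \<Delta>0 + \<Delta>')"
      using derivable.resolution[OF d1 d2, of Var A] \<Delta>0 \<Pi>0 by (simp add: subst_atm_Var)
    moreover have "set_mset (\<Pi> + \<Pi>0) \<subseteq> S" "set_mset (\<Delta>0 + \<Delta>') \<subseteq> T"
      using 1 2 \<Delta>0 \<Pi>0 by auto
    ultimately show ?thesis
      unfolding derives_def by blast
  next
    \<comment> \<open>A premise whose clause lacks \<open>A\<close> on the cut side already
      witnesses the conclusion.\<close>
    case False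
    then show ?thesis
      using 1 2 unfolding derives_def by (metis subset_insert)
  qed
qed

text \<open>Case distinction: \<open>T\<close> lists the possible cases under \<open>S\<close>, and
  refuting each one refutes \<open>S\<close>. The cases are cut away one at a time.\<close>

lemma derives_cut_all:
  assumes "finite T" "derives \<C> S T" "\<And>A. A \<in> T \<Longrightarrow> derives \<C> (insert A S) {}"
  shows "derives \<C> S {}"
  using assms
proof (induction T rule: finite_induct)
  case (insert A T)
  have "derives \<C> (insert A S) T"
    using insert.prems(2)[of A] by (auto intro: derives_mono)
  then have "derives \<C> S T"
    using insert.prems(1) by (rule derives_cut[rotated])
  then show ?case
    using insert.IH insert.prems(2) by blast
qed

lemma derives_C1: "derives (C n) {} {Leq u u}"
  using derives_subst[OF derives_input[of "{#}" "{# Leq \<alpha> \<alpha> #}" "C n"], of "\<lambda>_. u"]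
  by (simp add: C_def)

lemma derives_C2: "derives (C n) {Leq (MaxT u v) w} {Leq u w}"
  using derives_subst[OF derives_input[of "{# Leq (MaxT \<alpha> \<beta>) \<gamma> #}" "{# Leq \<alpha> \<gamma> #}" "C n"],
      of "\<lambda>x. if x = 0 then u else if x = 1 then v else w"]
  by (simp add: C_def)

lemma derives_C3: "derives (C n) {Leq (MaxT u v) w} {Leq v w}"
  using derives_subst[OF derives_input[of "{# Leq (MaxT \<alpha> \<beta>) \<gamma> #}" "{# Leq \<beta> \<gamma> #}" "C n"],
      of "\<lambda>x. if x = 0 then u else if x = 1 then v else w"]
  by (simp add: C_def)

lemma derives_C4:
  assumes "i \<le> n"
  shows "derives (C n) {FEq v i, FEq u i, Leq (Succ v) u} {}"
proof -
  have "({# FEq \<beta> i, FEq \<alpha> i, Leq (Succ \<beta>) \<alpha> #} \<turnstile> {#}) \<in> C n"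
    using assms unfolding C_def by blast
  from derives_subst[OF derives_input[OF this], of "\<lambda>x. if x = 0 then u else v"]
  show ?thesis
    by simp
qed

lemma derives_C5: "derives (C n) {} (FEq u ` {..n})"
  using derives_subst[OF derives_input[of "{#}" "{# FEq \<alpha> i. i \<in># mset_set {0..n} #}" "C n"],
      of "\<lambda>_. u"]
  by (simp add: C_def image_image atLeast0AtMost)

primrec tower :: "nat \<Rightarrow> trm" where
  "tower 0 = \<alpha>"
| "tower (Suc j) = MaxT (Succ (tower j)) (tower j)"

lemma derives_trans_unit:
  assumes "derives \<C> {} {A}" "derives \<C> {A} {B}"
  shows "derives \<C> {} {B}"
  by (rule derives_cut[of _ _ A]) (use assms in \<open>auto intro: derives_mono\<close>)

text \<open>Descending from \<open>j\<close>, (C3) strips the outer maximum of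
  \<open>tower (Suc i)\<close> and keeps its right argument \<open>tower i\<close>.\<close>

lemma tower_le:
  assumes "i \<le> j"
  shows "derives (C n) {} {Leq (tower i) (tower j)}"
  using assms
proof (induction rule: inc_induct)
  case base
  show ?case by (rule derives_C1)
next
  case (step i)
  then show ?case
    using derives_trans_unit derives_C3 by simp
qed

text \<open>\<open>Succ (tower i)\<close> is the left argument of \<open>tower (Suc i)\<close>,
  which lies below \<open>tower j\<close>; (C2) extracts it.\<close>

lemma Succ_tower_le:
  assumes "i < j"
  shows "derives (C n) {} {Leq (Succ (tower i)) (tower j)}"
  using derives_trans_unit[OF _ derives_C2] tower_le[of "Suc i" j n] assms by simp

lemma tower_conflict:
  assumes "i < j" "k \<le> n"
  shows "derives (C n) {FEq (tower i) k, FEq (tower j) k} {}"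
proof (rule derives_cut)
  show "derives (C n) {FEq (tower i) k, FEq (tower j) k} {Leq (Succ (tower i)) (tower j)}"
    using Succ_tower_le[OF assms(1)] by (rule derives_mono) auto
  show "derives (C n)
      (insert (Leq (Succ (tower i)) (tower j)) {FEq (tower i) k, FEq (tower j) k}) {}"
    using derives_C4[OF assms(2), of "tower i" "tower j"] by (rule derives_mono) auto
qed

text \<open>The function \<open>c\<close> encodes a branch of depth \<open>m\<close> in the decision
  tree. The induction runs from the leaves at depth \<open>n + 2\<close> down to the root
  \<open>m = 0\<close>, where no assumption is left.\<close>

lemma refute_assignment:
  assumes "m \<le> n + 2" "\<And>i. i < m \<Longrightarrow> c i \<le> n"
  shows "derives (C n) ((\<lambda>i. FEq (tower i) (c i)) ` {..<m}) {}"
  using assms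
proof (induction arbitrary: c rule: inc_induct)
  case base
  have "c ` {..<n + 2} \<subseteq> {..n}"
    using base by auto
  \<comment> \<open>There are \<open>n + 2\<close> towers but only \<open>n + 1\<close>
    values.\<close>
  then have "\<not> inj_on c {..<n + 2}"
    using card_inj_on_le[of c "{..<n + 2}" "{..n}"] by auto
  then obtain i j where ij: "i < j" "j < n + 2" "c i = c j"
    unfolding inj_on_def by (metis lessThan_iff linorder_neqE_nat)
  then have "derives (C n) {FEq (tower i) (c i), FEq (tower j) (c j)} {}"
    using tower_conflict base by simp
  then show ?case
    by (rule derives_mono) (use ij in auto)
next
  case (step m)
  let ?S = "(\<lambda>i. FEq (tower i) (c i)) ` {..<m}"
  show ?case
  proof (rule derives_cut_all)
    show "derives (C n) ?S (FEq (tower m) ` {..n})"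
      using derives_C5 by (rule derives_mono) auto
    fix A
    assume "A \<in> FEq (tower m) ` {..n}"
    then obtain k where k: "k \<le> n" "A = FEq (tower m) k"
      by auto
    \<comment> \<open>The branch is extended by the value \<open>k\<close> for
      \<open>tower m\<close>; the update keeps all values below \<open>m\<close>.\<close>
    have "derives (C n) ((\<lambda>i. FEq (tower i) ((c(m := k)) i)) ` {..<Suc m}) {}"
      using step.prems k by (intro step.IH) auto
    then show "derives (C n) (insert A ?S) {}"
      by (rule derives_mono) (use k in \<open>auto simp: less_Suc_eq\<close>)
  qed simp
qed

theorem theorem2:
  fixes n :: nat
  shows "derivable (C n) ({#} \<turnstile> {#})"
  using refute_assignment[of 0 n] by (simp add: derives_empty)

end
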